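(* Let $I=\left(-\frac{3\pi}{2},\frac{3\pi}{2}\right)$ and let $\mathbf T(t)=r(t)\,(\cos\theta(t),\sin\theta(t))$, $t\in I$, be a target curve, with scalar-valued functions $r,\theta:I\to\mathbb R$ such that $r(t)\neq0$ for all $t\in I$. Consider the triangle family $t\mapsto\mathbf\Psi(t)=(\Psi_1(t),\Psi_2(t),\Psi_3(t))$ given by $$\Psi_1(t)=1+r(t)\left(\cos\tfrac{\theta(t)}3+\sqrt3\sin\tfrac{\theta(t)}3\right),\quad \Psi_2(t)=1+r(t)\left(\cos\tfrac{\theta(t)}3-\sqrt3\sin\tfrac{\theta(t)}3\right),\quad \Psi_3(t)=1-2r(t)\cos\tfrac{\theta(t)}3 .$$ Let $\Omega_\sigma$ and $\Omega_{\mathrm{inv},\sigma}$ be the sets of triangle center functions defined in the context. If $\psi\in\Omega_\sigma$, then for every (non-equilateral) triangle $\Delta$ the triangle curve $t\mapsto\mathbf X_\psi^{\mathbf\Psi}(t)$ is a sheared version of the target curve, i.e. it is the image of $t\mapsto\mathbf T(t)$ under an affine transformation depending only on $\Delta$ and $\psi$. If $\psi\in\Omega_{\mathrm{inv},\sigma}$, the resulting curves are unsheared, i.e. this transformation is composed of translations, rotations, reflections and uniform scalings.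
   Context: **Triangles and centers.** $\triangle$ is the set of non-degenerate triangles $\Delta=(\mathbf A,\mathbf B,\mathbf C)$ in $\mathbb R^2$, with side lengths $a=|\mathbf B\mathbf C|$, $b=|\mathbf C\mathbf A|$, $c=|\mathbf A\mathbf B|$ and area $\mathrm{area}(\Delta)$ (a function of $a,b,c$). A triangle center function is a function $\psi\not\equiv 0$ of $(a,b,c)$ that is homogeneous of some real degree and satisfies $\psi(a,b,c)=\psi(a,c,b)$. Its trace is $\Sigma_\psi=a\psi(a,b,c)+b\psi(b,c,a)+c\psi(c,a,b)$, and it defines the triangle center $\mathbf X_\psi=\frac{1}{\Sigma_\psi}\left(a\psi(a,b,c)\mathbf A+b\psi(b,c,a)\mathbf B+c\psi(c,a,b)\mathbf C\right)$ whenever $\Sigma_\psi\ne0$. For $\psi^{-1}=1/\psi$ the trilinear coordinates $[1/\psi(a,b,c):1/\psi(b,c,a):1/\psi(c,a,b)]$ are read, if necessary after clearing denominators, as $[\psi(b,c,a)\psi(c,a,b):\psi(c,a,b)\psi(a,b,c):\psi(a,b,c)\psi(b,c,a)]$. $\mathbf X_2=\frac13(\mathbf A+\mathbf B+\mathbf C)$ is the centroid, with center function $\phi_2(a,b,c)=a^{-1}$, $\Sigma_{\phi_2}=3$. **The sets.** For real $(\lambda_0,\lambda_1)\neq(0,0)$ put $$\psi_{\Gamma;\lambda_0:\lambda_1}=\sqrt3\,a(-a^2+b^2+c^2)\lambda_0+4a\,\mathrm{area}(\Delta)\lambda_1,\qquad \psi_{\Xi;\lambda_0:\lambda_1}=-a(-a^2+b^2+c^2)\lambda_0+a(a^2+b^2+c^2)\lambda_1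 .$$ $\Gamma$, $\Xi$ are the sets of all these functions, $\Gamma^{-1}$, $\Xi^{-1}$ the sets of their reciprocals, and $\Omega=\Gamma\cup\Gamma^{-1}\cup\Xi\cup\Xi^{-1}$. $\Omega_{\mathrm{inv}}$ consists of the center functions $\psi_{\Gamma;1:1},\ \psi_{\Gamma;-1:1},\ \psi_{\Gamma;1:1}^{-1},\ \psi_{\Gamma;-1:1}^{-1}$ (the centers $\mathbf X_{15},\mathbf X_{16},\mathbf X_{13},\mathbf X_{14}$). For a set $S$ of triangle center functions, its scaled family is $S_\sigma=\{\psi_\sigma\mid\psi\in S,\ \sigma\in\mathbb R\}$ with $\psi_\sigma=(1-\sigma)\frac{\psi}{\Sigma_\psi}+\sigma\frac{\phi_2}{\Sigma_{\phi_2}}$, so that $\mathbf X_{\psi_\sigma}=(1-\sigma)\mathbf X_\psi+\sigma\mathbf X_2$; $\Omega_\sigma$ and $\Omega_{\mathrm{inv},\sigma}$ are the scaled families of $\Omega$ and $\Omega_{\mathrm{inv}}$. **Triangle families and curves.** A triangle family $\mathbf\Psi=(\Psi_1,\Psi_2,\Psi_3)$ (with $\Psi_1+\Psi_2+\Psi_3\neq0$ everywhere and not $\Psi_1\equiv\Psi_2\equiv\Psi_3$) applied to $\Delta$ yields triangles $\Delta_t^{\mathbf\Psi}$ with vertices of barycentric coordinates $\mathbf A_t=[\Psi_1:\Psi_2:\Psi_3]$, $\mathbf B_t=[\Psi_3:\Psi_1:\Psi_2]$, $\mathbf C_t=[\Psi_2:\Psi_3:\Psi_1]$ (evaluated at $t$)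 with respect to $\mathbf A,\mathbf B,\mathbf C$. $\mathbf X_\psi^{\mathbf\Psi}(t)$ is the center of $\Delta_t^{\mathbf\Psi}$ determined by $\psi$ (using the side lengths of $\Delta_t^{\mathbf\Psi}$). Equilateral $\Delta$ are excluded, curves are considered where the center is defined, and the affine transformation may be degenerate for special $\Delta,\psi$ (e.g. when $\mathbf X_\psi$ is the centroid). *)

theory Defs
  imports "HOL-Analysis.Analysis"
begin

section \<open>Triangles\<close>

type_synonym point = "real ^ 2"
type_synonym triangle = "point \<times> point \<times> point"

definition triangles :: "triangle set" where
  "triangles = {(A, B, C). \<not> collinear {A, B, C}}"

definition equilateral :: "triangle \<Rightarrow> bool" where
  "equilateral \<Delta> \<longleftrightarrow> (case \<Delta> of (A, B, C) \<Rightarrow> dist B C = dist C A \<and> dist C A = dist A B)"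

text \<open>The area as a function of the side lengths; on the side lengths of a triangle this is the
  Lebesgue measure of the triangle, see \<open>area_sides_eq_content\<close>.\<close>

definition area_sides :: "real \<Rightarrow> real \<Rightarrow> real \<Rightarrow> real" where
  "area_sides a b c = (let s = (a + b + c) / 2 in sqrt (s * (s - a) * (s - b) * (s - c)))"

lemma area_sides_eq_content:
  fixes A B C :: point
  shows "area_sides (dist B C) (dist C A) (dist A B) = measure lborel (convex hull {A, B, C})"
  by (simp add: heron area_sides_def Let_def dist_commute)

section \<open>Triangle center functions and triangle centers\<close>

type_synonym center_fun = "real \<Rightarrow> real \<Rightarrow> real \<Rightarrow> real"

definition center_trace :: "center_fun \<Rightarrow> center_fun" where
  "center_trace \<psi> a b c = a * \<psi> a b c + b * \<psi> b c a + c * \<psi> c a b"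

definition center_defined :: "center_fun \<Rightarrow> triangle \<Rightarrow> bool" where
  "center_defined \<psi> \<Delta> \<longleftrightarrow>
    (case \<Delta> of (A, B, C) \<Rightarrow> center_trace \<psi> (dist B C) (dist C A) (dist A B) \<noteq> 0)"

text \<open>The value is only meaningful if \<open>center_defined \<psi> \<Delta>\<close> holds.\<close>

definition center :: "center_fun \<Rightarrow> triangle \<Rightarrow> point" where
  "center \<psi> \<Delta> = (case \<Delta> of (A, B, C) \<Rightarrow>
    let a = dist B C; b = dist C A; c = dist A B
    in (1 / center_trace \<psi> a b c) *\<^sub>R
         ((a * \<psi> a b c) *\<^sub>R A + (b * \<psi> b c a) *\<^sub>R B + (c * \<psi> c a b) *\<^sub>R C))"

text \<open>The reciprocal center function, after clearing denominators: multiplying the trilinear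
  coordinates \<open>[1/\<psi>(a,b,c) : 1/\<psi>(b,c,a) : 1/\<psi>(c,a,b)]\<close> by the product of the three values of
  \<open>\<psi>\<close> gives \<open>[\<psi>(b,c,a)\<psi>(c,a,b) : \<psi>(c,a,b)\<psi>(a,b,c) : \<psi>(a,b,c)\<psi>(b,c,a)]\<close>.\<close>

definition recip :: "center_fun \<Rightarrow> center_fun" where
  "recip \<psi> a b c = \<psi> b c a * \<psi> c a b"

definition \<phi>\<^sub>2 :: center_fun where
  "\<phi>\<^sub>2 a b c = 1 / a"

text \<open>\<open>scaled \<psi> \<sigma>\<close> is undefined where the trace of \<open>\<psi>\<close> vanishes. It is set to 0 there, so that its
  own trace vanishes as well and its center is undefined in the sense of \<open>center_defined\<close>.\<close>

definition scaled :: "center_fun \<Rightarrow> real \<Rightarrow> center_fun" where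
  "scaled \<psi> \<sigma> a b c =
    (if center_trace \<psi> a b c = 0 then 0
     else (1 - \<sigma>) * (\<psi> a b c / center_trace \<psi> a b c)
            + \<sigma> * (\<phi>\<^sub>2 a b c / center_trace \<phi>\<^sub>2 a b c))"

definition scaled_family :: "center_fun set \<Rightarrow> center_fun set" where
  "scaled_family S = {scaled \<psi> \<sigma> | \<psi> \<sigma>. \<psi> \<in> S}"

section \<open>The sets of center functions\<close>

definition \<psi>\<^sub>\<Gamma> :: "real \<Rightarrow> real \<Rightarrow> center_fun" where
  "\<psi>\<^sub>\<Gamma> l0 l1 a b c = sqrt 3 * a * (- a\<^sup>2 + b\<^sup>2 + c\<^sup>2) * l0 + 4 * a * area_sides a b c * l1"

definition \<psi>\<^sub>\<Xi> :: "real \<Rightarrow> real \<Rightarrow> center_fun" where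
  "\<psi>\<^sub>\<Xi> l0 l1 a b c = - a * (- a\<^sup>2 + b\<^sup>2 + c\<^sup>2) * l0 + a * (a\<^sup>2 + b\<^sup>2 + c\<^sup>2) * l1"

definition Gamma_set :: "center_fun set" where
  "Gamma_set = {\<psi>\<^sub>\<Gamma> l0 l1 | l0 l1. (l0, l1) \<noteq> (0, 0)}"

definition Xi_set :: "center_fun set" where
  "Xi_set = {\<psi>\<^sub>\<Xi> l0 l1 | l0 l1. (l0, l1) \<noteq> (0, 0)}"

definition Omega :: "center_fun set" where
  "Omega = Gamma_set \<union> recip ` Gamma_set \<union> Xi_set \<union> recip ` Xi_set"

definition Omega_inv :: "center_fun set" where
  "Omega_inv = {\<psi>\<^sub>\<Gamma> 1 1, \<psi>\<^sub>\<Gamma> (-1) 1, recip (\<psi>\<^sub>\<Gamma> 1 1), recip (\<psi>\<^sub>\<Gamma> (-1) 1)}"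

lemma Omega_inv_scaled_subset: "scaled_family Omega_inv \<subseteq> scaled_family Omega"
proof -
  have "\<psi>\<^sub>\<Gamma> 1 1 \<in> Gamma_set" "\<psi>\<^sub>\<Gamma> (-1) 1 \<in> Gamma_set"
    by (auto simp: Gamma_set_def intro!: exI)
  then have "Omega_inv \<subseteq> Omega"
    by (auto simp: Omega_inv_def Omega_def)
  then show ?thesis
    by (auto simp: scaled_family_def)
qed

section \<open>Triangle families\<close>

definition bary_point :: "triangle \<Rightarrow> real \<Rightarrow> real \<Rightarrow> real \<Rightarrow> point" where
  "bary_point \<Delta> u v w = (case \<Delta> of (A, B, C) \<Rightarrow>
    (1 / (u + v + w)) *\<^sub>R (u *\<^sub>R A + v *\<^sub>R B + w *\<^sub>R C))"

definition family_triangle :: "(real \<Rightarrow> real \<times> real \<times> real) \<Rightarrow> triangle \<Rightarrow> real \<Rightarrow> triangle" where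
  "family_triangle \<Psi> \<Delta> t = (case \<Psi> t of (p1, p2, p3) \<Rightarrow>
    (bary_point \<Delta> p1 p2 p3, bary_point \<Delta> p3 p1 p2, bary_point \<Delta> p2 p3 p1))"

definition param_interval :: "real set" where
  "param_interval = {- (3 * pi / 2) <..< 3 * pi / 2}"

definition target_curve :: "(real \<Rightarrow> real) \<Rightarrow> (real \<Rightarrow> real) \<Rightarrow> real \<Rightarrow> point" where
  "target_curve r \<theta> t = r t *\<^sub>R vector [cos (\<theta> t), sin (\<theta> t)]"

definition target_family ::
  "(real \<Rightarrow> real) \<Rightarrow> (real \<Rightarrow> real) \<Rightarrow> real \<Rightarrow> real \<times> real \<times> real" where
  "target_family r \<theta> t =
    (1 + r t * (cos (\<theta> t / 3) + sqrt 3 * sin (\<theta> t / 3)),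
     1 + r t * (cos (\<theta> t / 3) - sqrt 3 * sin (\<theta> t / 3)),
     1 - 2 * r t * cos (\<theta> t / 3))"

section \<open>Affine transformations of the plane\<close>

text \<open>Degenerate affine transformations are admitted: the center may be the centroid, whose curve
  is constant. For the same reason the factor of a uniform scaling may be 0 in \<open>unsheared\<close>.\<close>

definition affine_transformation :: "(point \<Rightarrow> point) \<Rightarrow> bool" where
  "affine_transformation F \<longleftrightarrow> (\<exists>L d. linear L \<and> F = (\<lambda>x. L x + d))"

inductive unsheared :: "(point \<Rightarrow> point) \<Rightarrow> bool" where
  translation: "unsheared (\<lambda>x. x + d)"
| rotation: "rotation_matrix Q \<Longrightarrow> unsheared (\<lambda>x. Q *v x)"
| reflection: "norm u = 1 \<Longrightarrow> unsheared (\<lambda>x. (2 * (x \<bullet> u)) *\<^sub>R u - x)"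
| scaling: "unsheared (\<lambda>x. k *\<^sub>R x)"
| composition: "unsheared F \<Longrightarrow> unsheared G \<Longrightarrow> unsheared (F \<circ> G)"

end

theory Submission
  imports Defs
begin

text \<open>
  Identify the plane with \<open>\<complex>\<close> and take the discrete Fourier transform of the vertices: with
  \<open>\<omega>\<close> a primitive cube root of unity, \<open>A = g + p + q\<close>, \<open>B = g + \<omega> p + \<omega>\<^sup>2 q\<close> and
  \<open>C = g + \<omega>\<^sup>2 p + \<omega> q\<close>, where \<open>g\<close> is the centroid and the two modes \<open>p\<close>, \<open>q\<close> are equilateral
  triangles of opposite orientation. A triangle family acts on the vertices as a real circulant
  matrix, so Fourier transform diagonalises it. For the target family the eigenvalues are
  \<open>1\<close> on \<open>g\<close>, \<open>c = r e\<^bsup>i(\<pi> - \<theta>)/3\<^esup>\<close> on \<open>p\<close> and the conjugate of \<open>c\<close> on \<open>q\<close>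
  (\<open>family_triangle_modal_triangle\<close>).

  Put \<open>N = |p|\<^sup>2\<close>, \<open>M = |q|\<^sup>2\<close> and let \<open>v\<close> be twice the real part of \<open>p\<close> times the conjugate of \<open>q\<close>.
  Then \<open>a\<^sup>2 = 3 (N + M - v)\<close>, relabelling the vertices cyclically leaves \<open>N\<close> and \<open>M\<close> alone, and the
  area is a multiple of \<open>|N - M|\<close>. Hence every function in \<open>\<Gamma>\<close> and \<open>\<Xi>\<close> has the form \<open>a (m + n v)\<close> with
  \<open>m\<close> a function of \<open>N\<close> and \<open>M\<close>, and the barycentric weights of the centers they and their
  reciprocals define are quadratic polynomials in \<open>v\<close> up to a common factor
  (\<open>quadratic_center_linear\<close>, \<open>quadratic_center_recip\<close>). For such weights the displacement of the
  center from the centroid is a real combination \<open>\<alpha> P + \<beta> Q\<close> of just two cubic expressions,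
  \<open>P = p\<^sup>2 cnj(q)\<close> and \<open>Q = cnj(p) q\<^sup>2\<close> (\<open>center_quadratic_center\<close>).

  Passing to the family triangle multiplies \<open>P\<close> by \<open>c\<^sup>3 = - r\<^sup>3 e\<^bsup>-i\<theta>\<^esup>\<close>, \<open>Q\<close> by the conjugate,
  and \<open>\<alpha>\<close>, \<open>\<beta>\<close> by \<open>r\<^bsup>-2\<^esup>\<close>. The division of the angle by three in the family is undone by the
  cubic degree, and the center runs through
  \<open>g - (\<alpha> P r e\<^bsup>-i\<theta>\<^esup> + \<beta> Q r e\<^bsup>i\<theta>\<^esup>)\<close>, which is a real affine image of the target point
  \<open>r e\<^bsup>i\<theta>\<^esup>\<close>. Scaling a center towards the centroid only multiplies the linear part by
  \<open>1 - \<sigma>\<close>. For the four centers in \<open>\<Omega>\<^sub>i\<^sub>n\<^sub>v\<close> one of \<open>\<alpha>\<close>, \<open>\<beta>\<close> is zero, because for them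
  \<open>m\<close> equals \<open>n N\<close> or \<open>n M\<close>; the linear part is then multiplication by a complex number, possibly
  preceded by conjugation, and so is a similarity or constant.
\<close>

section \<open>The plane as the complex numbers\<close>

definition pt :: "complex \<Rightarrow> point" where
  "pt z = vector [Re z, Im z]"

definition cpx :: "point \<Rightarrow> complex" where
  "cpx x = Complex (x $ 1) (x $ 2)"

lemma cpx_pt [simp]: "cpx (pt z) = z"
  by (simp add: cpx_def pt_def)

lemma pt_cpx [simp]: "pt (cpx x) = x"
  by (simp add: cpx_def pt_def vec_eq_iff forall_2)

lemma pt_add: "pt (x + y) = pt x + pt y"
  by (simp add: pt_def vec_eq_iff forall_2)

lemma pt_scaleR: "pt (of_real c * z) = c *\<^sub>R pt z"
  by (simp add: pt_def vec_eq_iff forall_2)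

lemma dist_pt: "dist (pt x) (pt y) = cmod (x - y)"
  by (simp add: pt_def dist_vec_def L2_set_def sum_2 dist_norm cmod_def)

lemma cpx_add: "cpx (x + y) = cpx x + cpx y"
  by (metis cpx_pt pt_add pt_cpx)

lemma cpx_scaleR: "cpx (c *\<^sub>R x) = of_real c * cpx x"
  by (metis cpx_pt pt_scaleR pt_cpx)

lemma target_curve_eq_pt: "target_curve r \<theta> t = pt (of_real (r t) * cis (\<theta> t))"
  by (simp add: target_curve_def pt_def vec_eq_iff forall_2)

text \<open>Every affine map of the plane has this form; it is conformal or anticonformal, or constant,
  exactly when one of the two complex coefficients vanishes.\<close>

definition real_affine :: "complex \<Rightarrow> complex \<Rightarrow> complex \<Rightarrow> point \<Rightarrow> point" where
  "real_affine d u v x = pt (d + u * cpx x + v * cnj (cpx x))"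

lemma affine_transformation_real_affine: "affine_transformation (real_affine d u v)"
proof -
  let ?L = "\<lambda>x. pt (u * cpx x + v * cnj (cpx x))"
  have "linear ?L"
    by (rule linearI)
      (simp_all add: cpx_add cpx_scaleR pt_add [symmetric] pt_scaleR [symmetric] algebra_simps)
  moreover have "real_affine d u v = (\<lambda>x. ?L x + pt d)"
    by (simp add: fun_eq_iff real_affine_def pt_add [symmetric] add_ac)
  ultimately show ?thesis
    unfolding affine_transformation_def by blast
qed

lemma unsheared_cmult_unit:
  assumes "cmod u = 1"
  shows "unsheared (\<lambda>x. pt (u * cpx x))"
proof -
  define Q :: "real^2^2" where "Q = vector [vector [Re u, - Im u], vector [Im u, Re u]]"
  have sq: "Re u * Re u + Im u * Im u = 1"
    using assms by (simp add: cmod_def power2_eq_square)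
  have "transpose Q ** Q = mat 1"
    using sq
    by (simp add: Q_def matrix_matrix_mult_def transpose_def mat_def vec_eq_iff forall_2 sum_2 ac_simps)
  moreover have "det Q = 1"
    using sq by (simp add: Q_def det_2)
  ultimately have "rotation_matrix Q"
    by (simp add: rotation_matrix_def orthogonal_matrix)
  then have "unsheared (\<lambda>x. Q *v x)"
    by (rule unsheared.rotation)
  moreover have "Q *v x = pt (u * cpx x)" for x
    by (simp add: Q_def pt_def cpx_def matrix_vector_mult_def vec_eq_iff forall_2 sum_2)
  ultimately show ?thesis
    by simp
qed

lemma unsheared_cmult: "unsheared (\<lambda>x. pt (u * cpx x))"
proof -
  obtain e where e: "cmod e = 1" "u = of_real (cmod u) * e"
    using that [of "cis (Arg u)"] rcis_cmod_Arg [of u] by (simp add: rcis_def)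
  have "unsheared ((\<lambda>x. cmod u *\<^sub>R x) \<circ> (\<lambda>x. pt (e * cpx x)))"
    using e by (intro unsheared.composition unsheared.scaling unsheared_cmult_unit)
  moreover have "(\<lambda>x. cmod u *\<^sub>R x) \<circ> (\<lambda>x. pt (e * cpx x)) = (\<lambda>x. pt (u * cpx x))"
    by (subst (2) e(2)) (simp add: fun_eq_iff pt_scaleR [symmetric] mult.assoc)
  ultimately show ?thesis
    by simp
qed

lemma unsheared_cnj: "unsheared (\<lambda>x. pt (cnj (cpx x)))"
proof -
  have "norm (vector [1, 0] :: point) = 1"
    by (simp add: norm_eq_sqrt_inner inner_vec_def sum_2)
  moreover have "(2 * (x \<bullet> vector [1, 0])) *\<^sub>R vector [1, 0] - x = pt (cnj (cpx x))" for x
    by (simp add: pt_def cpx_def vec_eq_iff forall_2 inner_vec_def sum_2)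
  ultimately show ?thesis
    using unsheared.reflection by fastforce
qed

text \<open>Multiplication by \<open>u\<close> is a rotation followed by scaling with \<open>|u|\<close>, and conjugation is the
  reflection in the first axis.\<close>

lemma unsheared_real_affine:
  assumes "u = 0 \<or> v = 0"
  shows "unsheared (real_affine d u v)"
proof -
  have tr: "unsheared (\<lambda>x. F x + pt d)" if "unsheared F" for F
    using unsheared.composition [OF unsheared.translation that] by (simp add: comp_def)
  have "unsheared (\<lambda>x. pt (u * cpx x) + pt d)"
    by (intro tr unsheared_cmult)
  moreover have "unsheared (\<lambda>x. pt (v * cnj (cpx x)) + pt d)"
    using unsheared.composition [OF unsheared_cmult unsheared_cnj, of v]
    by (intro tr) (simp add: comp_def)
  ultimately show ?thesis
    using assms by (auto simp: real_affine_def [abs_def] pt_add [symmetric] add.commute)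
qed

section \<open>Fourier modes of a triangle\<close>

definition \<omega> :: complex where
  "\<omega> = cis (2 * pi / 3)"

lemma omega_eq: "\<omega> = Complex (- 1 / 2) (sqrt 3 / 2)"
  by (simp add: \<omega>_def complex_eq_iff cos_120 sin_120)

lemma omega_mult_cnj: "\<omega> * cnj \<omega> = 1"
  by (simp add: \<omega>_def cis_cnj cis_mult)

lemma omega_add_cnj: "cnj \<omega> = - 1 - \<omega>"
  by (simp add: omega_eq complex_eq_iff)

lemma omega_sq: "\<omega> * \<omega> = cnj \<omega>"
  by (simp add: omega_eq complex_eq_iff)

lemma omega_rotate:
  "\<omega> * (\<omega> * z) = cnj \<omega> * z" "cnj \<omega> * (cnj \<omega> * z) = \<omega> * z"
  "\<omega> * (cnj \<omega> * z) = z" "cnj \<omega> * (\<omega> * z) = z"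
  using omega_mult_cnj omega_add_cnj omega_sq by algebra+

lemma norm_omega [simp]: "cmod \<omega> = 1"
  by (simp add: \<omega>_def)

text \<open>The inverse discrete Fourier transform of \<open>(g, p, q)\<close>. Writing \<open>cnj \<omega>\<close> for \<open>\<omega>\<^sup>2\<close> keeps the
  set of terms closed under conjugation.\<close>

definition modal_triangle :: "complex \<Rightarrow> complex \<Rightarrow> complex \<Rightarrow> triangle" where
  "modal_triangle g p q =
    (pt (g + p + q), pt (g + \<omega> * p + cnj \<omega> * q), pt (g + cnj \<omega> * p + \<omega> * q))"

lemma ex_modal_triangle: "\<exists>g p q. \<Delta> = modal_triangle g p q"
proof -
  obtain A B C where \<Delta>: "\<Delta> = (pt A, pt B, pt C)"
    by (metis pt_cpx prod_cases3)
  define g p q where "g = (A + B + C) / 3"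
    and "p = (A + cnj \<omega> * B + \<omega> * C) / 3" and "q = (A + \<omega> * B + cnj \<omega> * C) / 3"
  have s: "3 * g = A + B + C" "3 * p = A + cnj \<omega> * B + \<omega> * C" "3 * q = A + \<omega> * B + cnj \<omega> * C"
    by (simp_all add: g_def p_def q_def)
  have "3 * (g + p + q) = 3 * A" "3 * (g + \<omega> * p + cnj \<omega> * q) = 3 * B"
    "3 * (g + cnj \<omega> * p + \<omega> * q) = 3 * C"
    using s omega_mult_cnj omega_add_cnj omega_sq by algebra+
  then have "\<Delta> = modal_triangle g p q"
    by (simp only: \<Delta> modal_triangle_def mult_cancel_left) simp
  then show ?thesis
    by blast
qed

text \<open>Multiplying \<open>(p, q)\<close> by \<open>(\<omega>, cnj \<omega>)\<close> relabels the vertices cyclically, so this single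
  expression, evaluated at rotated modes, gives all three sides.\<close>

definition opp_side :: "complex \<Rightarrow> complex \<Rightarrow> real" where
  "opp_side p q = sqrt 3 * cmod (p - q)"

lemma sides_modal_triangle:
  assumes "modal_triangle g p q = (A, B, C)"
  shows "dist B C = opp_side p q"
    and "dist C A = opp_side (\<omega> * p) (cnj \<omega> * q)"
    and "dist A B = opp_side (cnj \<omega> * p) (\<omega> * q)"
proof -
  have n: "cmod (\<omega> - cnj \<omega>) = sqrt 3"
    by (simp add: omega_eq cmod_def)
  have "dist B C = cmod ((\<omega> - cnj \<omega>) * (p - q))"
    using assms by (auto simp: modal_triangle_def dist_pt algebra_simps)
  then show "dist B C = opp_side p q"
    by (simp add: norm_mult n opp_side_def)
  have e: "(g + cnj \<omega> * p + \<omega> * q) - (g + p + q) = (\<omega> - cnj \<omega>) * (\<omega> * p - cnj \<omega> * q)"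
    using omega_mult_cnj omega_add_cnj omega_sq by algebra
  have "dist C A = cmod ((g + cnj \<omega> * p + \<omega> * q) - (g + p + q))"
    using assms by (auto simp: modal_triangle_def dist_pt)
  then show "dist C A = opp_side (\<omega> * p) (cnj \<omega> * q)"
    unfolding e by (simp add: norm_mult n opp_side_def)
  have e: "(g + p + q) - (g + \<omega> * p + cnj \<omega> * q) = (\<omega> - cnj \<omega>) * (cnj \<omega> * p - \<omega> * q)"
    using omega_mult_cnj omega_add_cnj omega_sq by algebra
  have "dist A B = cmod ((g + p + q) - (g + \<omega> * p + cnj \<omega> * q))"
    using assms by (auto simp: modal_triangle_def dist_pt)
  then show "dist A B = opp_side (cnj \<omega> * p) (\<omega> * q)"
    unfolding e by (simp add: norm_mult n opp_side_def)
qed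

text \<open>The signed area is proportional to \<open>|p|\<^sup>2 - |q|\<^sup>2\<close>. If it vanishes, then the quotient of two
  sides, as complex numbers, is real, so the vertices lie on a line.\<close>

lemma nondegenerate_modes:
  assumes "modal_triangle g p q \<in> triangles"
  shows "cmod p \<noteq> cmod q"
proof
  assume eq: "cmod p = cmod q"
  let ?A = "g + p + q" and ?B = "g + \<omega> * p + cnj \<omega> * q" and ?C = "g + cnj \<omega> * p + \<omega> * q"
  have "collinear {pt ?B, pt ?A, pt ?C}"
  proof (cases "p = q")
    case True
    then show ?thesis
      by (simp add: collinear_3_expand add_ac)
  next
    case False
    \<comment> \<open>Up to the common factor \<open>\<omega> - cnj \<omega>\<close> this is the ratio of \<open>A - C\<close> to \<open>B - C\<close>.\<close>
    define z where "z = (cnj \<omega> * q - \<omega> * p) / (p - q)"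
    have "Im ((cnj \<omega> * q - \<omega> * p) * cnj (p - q)) = sqrt 3 / 2 * ((cmod q)\<^sup>2 - (cmod p)\<^sup>2)"
      unfolding cmod_power2
      by (simp add: omega_eq algebra_simps power2_eq_square)
    then have "Im z = 0"
      unfolding z_def by (subst Im_complex_div_eq_0) (simp add: eq)
    then have z: "z = of_real (Re z)"
      by (simp add: complex_eq_iff)
    have "z * (p - q) = cnj \<omega> * q - \<omega> * p"
      using False by (simp add: z_def)
    then have "?A = z * ?B + (1 - z) * ?C"
      using omega_mult_cnj omega_add_cnj omega_sq by algebra
    then have "?A = of_real (Re z) * ?B + of_real (1 - Re z) * ?C"
      by (subst (asm) (1 2) z) simp
    then have "pt ?A = Re z *\<^sub>R pt ?B + (1 - Re z) *\<^sub>R pt ?C"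
      by (metis pt_add pt_scaleR)
    then show ?thesis
      unfolding collinear_3_expand by blast
  qed
  then show False
    using assms by (simp add: triangles_def modal_triangle_def insert_commute)
qed

lemma bary_point_pt:
  "bary_point (pt A, pt B, pt C) u v w
    = pt ((of_real u * A + of_real v * B + of_real w * C) / of_real (u + v + w))"
proof -
  have "(of_real u * A + of_real v * B + of_real w * C) / of_real (u + v + w)
    = of_real (1 / (u + v + w)) * (of_real u * A + of_real v * B + of_real w * C)"
    by simp
  then show ?thesis
    by (simp only: bary_point_def pt_scaleR pt_add prod.case)
qed

text \<open>The family applies a circulant matrix to the vertices, and the Fourier modes are its
  eigenvectors. The coefficients of the family are chosen such that the eigenvalue on \<open>p\<close> has
  cube \<open>- r\<^sup>3 cis (- \<theta>)\<close>.\<close>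

lemma family_triangle_modal_triangle:
  fixes r \<theta> t
  defines "c \<equiv> of_real (r t) * cis ((pi - \<theta> t) / 3)"
  shows "family_triangle (target_family r \<theta>) (modal_triangle g p q) t
    = modal_triangle g (c * p) (cnj c * q)"
proof -
  obtain x y z where xyz: "target_family r \<theta> t = (x, y, z)"
    by (metis prod_cases3)
  then have
    x: "x = 1 + r t * (cos (\<theta> t / 3) + sqrt 3 * sin (\<theta> t / 3))" and
    y: "y = 1 + r t * (cos (\<theta> t / 3) - sqrt 3 * sin (\<theta> t / 3))" and
    z: "z = 1 - 2 * r t * cos (\<theta> t / 3)"
    by (simp_all add: target_family_def)
  have sum: "x + y + z = 3"
    by (simp add: x y z algebra_simps)
  then have sum': "complex_of_real x + of_real y + of_real z = 3"
    by (metis of_real_add of_real_numeral)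
  have eig: "of_real x + of_real y * \<omega> + of_real z * cnj \<omega> = 3 * c"
    by (simp add: x y z c_def omega_eq complex_eq_iff diff_divide_distrib cos_diff sin_diff
        cos_60 sin_60 algebra_simps)
  have eig': "of_real x + of_real y * cnj \<omega> + of_real z * \<omega> = 3 * cnj c"
    using arg_cong [OF eig, of cnj] by simp
  let ?A = "g + p + q" and ?B = "g + \<omega> * p + cnj \<omega> * q" and ?C = "g + cnj \<omega> * p + \<omega> * q"
  \<comment> \<open>Stated for all \<open>p\<close> and \<open>q\<close>, because the second and third vertex arise from the first one by
    rotating the modes.\<close>
  have vertex: "of_real x * (g + p + q) + of_real y * (g + \<omega> * p + cnj \<omega> * q)
      + of_real z * (g + cnj \<omega> * p + \<omega> * q) = 3 * (g + c * p + cnj c * q)" for p q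
  proof -
    have "of_real x * (g + p + q) + of_real y * (g + \<omega> * p + cnj \<omega> * q)
        + of_real z * (g + cnj \<omega> * p + \<omega> * q)
      = (of_real x + of_real y + of_real z) * g
        + (of_real x + of_real y * \<omega> + of_real z * cnj \<omega>) * p
        + (of_real x + of_real y * cnj \<omega> + of_real z * \<omega>) * q"
      by (simp add: algebra_simps)
    then show ?thesis
      unfolding sum' eig eig' by (simp add: algebra_simps)
  qed
  have "of_real x * ?A + of_real y * ?B + of_real z * ?C = 3 * (g + c * p + cnj c * q)"
    by (rule vertex)
  moreover have "of_real z * ?A + of_real x * ?B + of_real y * ?C
      = 3 * (g + \<omega> * (c * p) + cnj \<omega> * (cnj c * q))"
    using vertex [of "\<omega> * p" "cnj \<omega> * q", unfolded omega_rotate] by (simp add: algebra_simps)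
  moreover have "of_real y * ?A + of_real z * ?B + of_real x * ?C
      = 3 * (g + cnj \<omega> * (c * p) + \<omega> * (cnj c * q))"
    using vertex [of "cnj \<omega> * p" "\<omega> * q", unfolded omega_rotate] by (simp add: algebra_simps)
  moreover have "z + x + y = 3" "y + z + x = 3"
    using sum by simp_all
  ultimately show ?thesis
    by (simp only: family_triangle_def xyz modal_triangle_def bary_point_pt prod.case sum)
      (simp add: add_divide_distrib)
qed

section \<open>Center functions with quadratic weights\<close>

text \<open>The barycentric weight of the first vertex is a quadratic polynomial in \<open>v\<close>; those of the other
  vertices are the instances at the rotated modes, which have the same \<open>N\<close> and \<open>M\<close>. The factor \<open>\<kappa>\<close> is
  common to the three weights and cancels from the center; it absorbs the product \<open>a b c\<close> that
  occurs for reciprocals. The homogeneity of \<open>k\<^sub>0\<close> and \<open>k\<^sub>1\<close> makes the weights homogeneous of degree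
  four in the modes, apart from \<open>\<kappa>\<close>.\<close>

definition quadratic_center ::
  "center_fun \<Rightarrow> (real \<Rightarrow> real \<Rightarrow> real) \<Rightarrow> (real \<Rightarrow> real \<Rightarrow> real) \<Rightarrow> real \<Rightarrow> bool" where
  "quadratic_center \<psi> k\<^sub>0 k\<^sub>1 k\<^sub>2 \<longleftrightarrow>
    (\<forall>s N M. 0 < s \<longrightarrow> k\<^sub>0 (s * N) (s * M) = s\<^sup>2 * k\<^sub>0 N M \<and> k\<^sub>1 (s * N) (s * M) = s * k\<^sub>1 N M) \<and>
    (\<exists>\<kappa>. (\<forall>a b c. \<kappa> b c a = \<kappa> a b c) \<and>
      (\<forall>p q. let a = opp_side p q; b = opp_side (\<omega> * p) (cnj \<omega> * q);
                 c = opp_side (cnj \<omega> * p) (\<omega> * q);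
                 N = (cmod p)\<^sup>2; M = (cmod q)\<^sup>2; v = 2 * Re (p * cnj q)
             in a * \<psi> a b c = \<kappa> a b c * (k\<^sub>0 N M + k\<^sub>1 N M * v + k\<^sub>2 * v\<^sup>2)))"

text \<open>The offset of the center from the centroid, split into its components along \<open>p\<^sup>2 cnj(q)\<close> and
  \<open>cnj(p) q\<^sup>2\<close>, which transform differently under the family. The denominator \<open>d\<close> is a factor of the
  trace, so it is nonzero where the center is defined.\<close>

definition displacement ::
  "(real \<Rightarrow> real \<Rightarrow> real) \<Rightarrow> (real \<Rightarrow> real \<Rightarrow> real) \<Rightarrow> real \<Rightarrow> complex \<Rightarrow> complex \<Rightarrow> complex \<times> complex" where
  "displacement k\<^sub>0 k\<^sub>1 k\<^sub>2 p q =
    (let N = (cmod p)\<^sup>2; M = (cmod q)\<^sup>2; d = k\<^sub>0 N M + 2 * k\<^sub>2 * N * M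
     in (of_real ((k\<^sub>1 N M + k\<^sub>2 * M) / d) * (p\<^sup>2 * cnj q),
         of_real ((k\<^sub>1 N M + k\<^sub>2 * N) / d) * (cnj p * q\<^sup>2)))"

lemma of_real_2_Re: "complex_of_real (2 * Re z) = z + cnj z"
  by (simp add: complex_eq_iff)

text \<open>Let \<open>v, v', v''\<close> be the values of \<open>v\<close> at the three vertices and \<open>u = p cnj(q)\<close>. The sum of the
  weights only sees the zeroth Fourier coefficient of the weights, and the displacement only the two
  others. For the values of \<open>v\<close> these two are \<open>u\<close> and \<open>cnj(u)\<close>, for their squares \<open>cnj(u)\<^sup>2\<close> and
  \<open>u\<^sup>2\<close>; multiplied by the matching mode each of them becomes a real multiple of
  \<open>p\<^sup>2 cnj(q)\<close> or \<open>cnj(p) q\<^sup>2\<close>.\<close>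

lemma center_quadratic_center:
  assumes "quadratic_center \<psi> k\<^sub>0 k\<^sub>1 k\<^sub>2"
    and "center_defined \<psi> (modal_triangle g p q)"
    and "displacement k\<^sub>0 k\<^sub>1 k\<^sub>2 p q = (x, y)"
  shows "center \<psi> (modal_triangle g p q) = pt (g + x + y)"
proof -
  obtain A B C where T: "modal_triangle g p q = (A, B, C)"
    by (metis prod_cases3)
  note sides = sides_modal_triangle [OF T]
  define a b c where a: "a = opp_side p q" and b: "b = opp_side (\<omega> * p) (cnj \<omega> * q)"
    and c: "c = opp_side (cnj \<omega> * p) (\<omega> * q)"
  define N M where N: "N = (cmod p)\<^sup>2" and M: "M = (cmod q)\<^sup>2"
  define e\<^sub>0 e\<^sub>1 e\<^sub>2 where e: "e\<^sub>0 = 2 * Re (p * cnj q)" "e\<^sub>1 = 2 * Re (\<omega> * p * cnj (cnj \<omega> * q))"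
    "e\<^sub>2 = 2 * Re (cnj \<omega> * p * cnj (\<omega> * q))"
  obtain \<kappa> where \<kappa>: "\<And>a b c. \<kappa> b c a = \<kappa> a b c"
    and w: "\<And>p q. opp_side p q * \<psi> (opp_side p q) (opp_side (\<omega> * p) (cnj \<omega> * q))
        (opp_side (cnj \<omega> * p) (\<omega> * q))
      = \<kappa> (opp_side p q) (opp_side (\<omega> * p) (cnj \<omega> * q)) (opp_side (cnj \<omega> * p) (\<omega> * q))
        * (k\<^sub>0 ((cmod p)\<^sup>2) ((cmod q)\<^sup>2) + k\<^sub>1 ((cmod p)\<^sup>2) ((cmod q)\<^sup>2) * (2 * Re (p * cnj q))
           + k\<^sub>2 * (2 * Re (p * cnj q))\<^sup>2)"
    using assms(1) unfolding quadratic_center_def Let_def by blast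
  define K L R where "K = k\<^sub>0 N M" and "L = k\<^sub>1 N M" and "R = \<kappa> a b c"
  define W\<^sub>0 W\<^sub>1 W\<^sub>2 where W: "W\<^sub>0 = K + L * e\<^sub>0 + k\<^sub>2 * e\<^sub>0\<^sup>2" "W\<^sub>1 = K + L * e\<^sub>1 + k\<^sub>2 * e\<^sub>1\<^sup>2"
    "W\<^sub>2 = K + L * e\<^sub>2 + k\<^sub>2 * e\<^sub>2\<^sup>2"
  have wa: "a * \<psi> a b c = R * W\<^sub>0"
    using w [of p q] by (simp only: a b c N M K_def L_def R_def W e)
  have wb: "b * \<psi> b c a = R * W\<^sub>1"
    using w [of "\<omega> * p" "cnj \<omega> * q"] \<kappa> [where a = a and b = b and c = c]
    by (simp add: omega_rotate a b c N M K_def L_def R_def W e norm_mult)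
  have wc: "c * \<psi> c a b = R * W\<^sub>2"
    using w [of "cnj \<omega> * p" "\<omega> * q"] \<kappa> [where a = c and b = a and c = b]
    by (simp add: omega_rotate a b c N M K_def L_def R_def W e norm_mult)
  have ec: "of_real e\<^sub>0 = p * cnj q + cnj p * q"
    "of_real e\<^sub>1 = cnj \<omega> * (p * cnj q) + \<omega> * (cnj p * q)"
    "of_real e\<^sub>2 = \<omega> * (p * cnj q) + cnj \<omega> * (cnj p * q)"
    unfolding e of_real_2_Re using omega_sq by (simp_all add: omega_mult_cnj omega_rotate algebra_simps)
  have NM: "of_real N = p * cnj p" "of_real M = q * cnj q"
    by (simp_all add: N M complex_norm_square del: of_real_power)
  define D where "D = K + 2 * k\<^sub>2 * N * M"
  have Wc: "of_real W\<^sub>0 = of_real K + of_real L * complex_of_real e\<^sub>0 + of_real k\<^sub>2 * (of_real e\<^sub>0)\<^sup>2"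
     "of_real W\<^sub>1 = of_real K + of_real L * complex_of_real e\<^sub>1 + of_real k\<^sub>2 * (of_real e\<^sub>1)\<^sup>2"
     "of_real W\<^sub>2 = of_real K + of_real L * complex_of_real e\<^sub>2 + of_real k\<^sub>2 * (of_real e\<^sub>2)\<^sup>2"
    by (simp_all add: W)
  have "of_real (W\<^sub>0 + W\<^sub>1 + W\<^sub>2) = complex_of_real (3 * D)"
    unfolding of_real_add Wc ec D_def of_real_mult NM of_real_numeral
    using omega_mult_cnj omega_add_cnj omega_sq by algebra
  then have sumW: "W\<^sub>0 + W\<^sub>1 + W\<^sub>2 = 3 * D"
    by (simp only: of_real_eq_iff)
  have tr: "center_trace \<psi> a b c = R * (3 * D)"
    unfolding center_trace_def wa wb wc sumW [symmetric] by (simp add: algebra_simps)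
  then have nz: "R \<noteq> 0" "D \<noteq> 0"
    using assms(2) by (auto simp: center_defined_def T sides a b c)
  have moment: "of_real W\<^sub>0 * (p + q) + of_real W\<^sub>1 * (\<omega> * p + cnj \<omega> * q)
      + of_real W\<^sub>2 * (cnj \<omega> * p + \<omega> * q)
    = 3 * ((of_real L + of_real k\<^sub>2 * of_real M) * (p\<^sup>2 * cnj q)
         + (of_real L + of_real k\<^sub>2 * of_real N) * (cnj p * q\<^sup>2))"
    unfolding Wc ec NM using omega_mult_cnj omega_add_cnj omega_sq by algebra
  have "x = of_real ((L + k\<^sub>2 * M) / D) * (p\<^sup>2 * cnj q)"
    "y = of_real ((L + k\<^sub>2 * N) / D) * (cnj p * q\<^sup>2)"
    using assms(3) unfolding displacement_def Let_def N [symmetric] M [symmetric]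
      K_def [symmetric] L_def [symmetric] D_def [symmetric] by simp_all
  with nz(2) have xy: "of_real D * x = (of_real L + of_real k\<^sub>2 * of_real M) * (p\<^sup>2 * cnj q)"
    "of_real D * y = (of_real L + of_real k\<^sub>2 * of_real N) * (cnj p * q\<^sup>2)"
    by simp_all
  have sumW': "of_real W\<^sub>0 + of_real W\<^sub>1 + of_real W\<^sub>2 = 3 * complex_of_real D"
    by (metis sumW of_real_add of_real_mult of_real_numeral)
  have "of_real (R * W\<^sub>0) * (g + p + q) + of_real (R * W\<^sub>1) * (g + \<omega> * p + cnj \<omega> * q)
      + of_real (R * W\<^sub>2) * (g + cnj \<omega> * p + \<omega> * q) = of_real (R * (3 * D)) * (g + x + y)"
    unfolding of_real_mult of_real_numeral using moment xy sumW' by algebra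
  then have "of_real (1 / (R * (3 * D))) *
      (of_real (R * W\<^sub>0) * (g + p + q) + of_real (R * W\<^sub>1) * (g + \<omega> * p + cnj \<omega> * q)
      + of_real (R * W\<^sub>2) * (g + cnj \<omega> * p + \<omega> * q)) = g + x + y"
    using nz by simp
  moreover have "A = pt (g + p + q)" "B = pt (g + \<omega> * p + cnj \<omega> * q)"
    "C = pt (g + cnj \<omega> * p + \<omega> * q)"
    using T by (auto simp: modal_triangle_def)
  ultimately show ?thesis
    unfolding T center_def prod.case sides Let_def a [symmetric] b [symmetric] c [symmetric]
      tr wa wb wc by (metis pt_scaleR pt_add)
qed

lemma center_trace_rotate: "center_trace \<psi> b c a = center_trace \<psi> a b c"
  by (simp add: center_trace_def)

text \<open>Where the trace of \<open>\<psi>\<close> is nonzero, the scaled function has trace 1, so its weights are already normalised barycentric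
  coordinates. Distinct vertices are required because \<open>a \<phi>\<^sub>2(a,b,c)\<close> is 1 only for
  \<open>a \<noteq> 0\<close>.\<close>

lemma center_scaled:
  assumes def: "center_defined (scaled \<psi> \<sigma>) (A, B, C)"
    and distinct: "A \<noteq> B" "B \<noteq> C" "C \<noteq> A"
  shows "center_defined \<psi> (A, B, C)"
    and "center (scaled \<psi> \<sigma>) (A, B, C)
      = (1 - \<sigma>) *\<^sub>R center \<psi> (A, B, C) + \<sigma> *\<^sub>R ((1 / 3) *\<^sub>R (A + B + C))"
proof -
  define a b c where abc: "a = dist B C" "b = dist C A" "c = dist A B"
  have nz: "a \<noteq> 0" "b \<noteq> 0" "c \<noteq> 0"
    using distinct by (auto simp: abc)
  define S where "S = center_trace \<psi> a b c"
  have rot: "center_trace \<psi> b c a = S" "center_trace \<psi> c a b = S"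
    by (simp_all add: S_def center_trace_rotate)
  have S: "S \<noteq> 0"
  proof
    assume "S = 0"
    then have "center_trace (scaled \<psi> \<sigma>) a b c = 0"
      using rot S_def by (simp add: center_trace_def [of "scaled \<psi> \<sigma>"] scaled_def)
    then show False
      using def by (simp add: center_defined_def abc)
  qed
  then show "center_defined \<psi> (A, B, C)"
    by (simp add: center_defined_def S_def abc)
  have tr2: "center_trace \<phi>\<^sub>2 a b c = 3" "center_trace \<phi>\<^sub>2 b c a = 3" "center_trace \<phi>\<^sub>2 c a b = 3"
    using nz by (simp_all add: center_trace_def \<phi>\<^sub>2_def)
  have w: "a * scaled \<psi> \<sigma> a b c = (1 - \<sigma>) * (a * \<psi> a b c / S) + \<sigma> / 3"
    "b * scaled \<psi> \<sigma> b c a = (1 - \<sigma>) * (b * \<psi> b c a / S) + \<sigma> / 3"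
    "c * scaled \<psi> \<sigma> c a b = (1 - \<sigma>) * (c * \<psi> c a b / S) + \<sigma> / 3"
    unfolding scaled_def tr2 rot S_def [symmetric] using S nz
    by (simp_all add: \<phi>\<^sub>2_def algebra_simps)
  have "a * \<psi> a b c / S + b * \<psi> b c a / S + c * \<psi> c a b / S = 1"
    using S by (simp add: S_def center_trace_def add_divide_distrib [symmetric])
  moreover have "center_trace (scaled \<psi> \<sigma>) a b c
      = (1 - \<sigma>) * (a * \<psi> a b c / S + b * \<psi> b c a / S + c * \<psi> c a b / S) + \<sigma>"
    unfolding center_trace_def w by (simp add: algebra_simps)
  ultimately have tr: "center_trace (scaled \<psi> \<sigma>) a b c = 1"
    by simp
  show "center (scaled \<psi> \<sigma>) (A, B, C)
      = (1 - \<sigma>) *\<^sub>R center \<psi> (A, B, C) + \<sigma> *\<^sub>R ((1 / 3) *\<^sub>R (A + B + C))"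
    unfolding center_def prod.case Let_def abc [symmetric] tr w S_def [symmetric]
    by (simp add: algebra_simps)
qed

section \<open>The families of center functions\<close>

text \<open>The common shape of the functions in \<open>\<Gamma>\<close> and \<open>\<Xi>\<close>.\<close>

definition linear_center :: "center_fun \<Rightarrow> (real \<Rightarrow> real \<Rightarrow> real) \<Rightarrow> real \<Rightarrow> bool" where
  "linear_center \<psi> m n \<longleftrightarrow>
    (\<forall>s N M. 0 < s \<longrightarrow> m (s * N) (s * M) = s * m N M) \<and>
    (\<forall>p q. let a = opp_side p q; b = opp_side (\<omega> * p) (cnj \<omega> * q);
               c = opp_side (cnj \<omega> * p) (\<omega> * q);
               N = (cmod p)\<^sup>2; M = (cmod q)\<^sup>2; v = 2 * Re (p * cnj q)
           in \<psi> a b c = a * (m N M + n * v))"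

lemma opp_side_sq: "(opp_side p q)\<^sup>2 = 3 * ((cmod p)\<^sup>2 + (cmod q)\<^sup>2 - 2 * Re (p * cnj q))"
  unfolding opp_side_def power_mult_distrib cmod_power2 by (simp add: power2_eq_square algebra_simps)

text \<open>The three values of \<open>v\<close> are the roots of a cubic polynomial without quadratic term, whose
  linear coefficient is \<open>- 3 |p|\<^sup>2 |q|\<^sup>2\<close>. This expresses symmetric functions of two of them by the third.\<close>

lemma rotated_Re:
  fixes p q
  defines "v \<equiv> 2 * Re (p * cnj q)"
    and "v' \<equiv> 2 * Re (\<omega> * p * cnj (cnj \<omega> * q))"
    and "v'' \<equiv> 2 * Re (cnj \<omega> * p * cnj (\<omega> * q))"
  shows "v' + v'' = - v" and "v' * v'' = v\<^sup>2 - 3 * (cmod p)\<^sup>2 * (cmod q)\<^sup>2"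
proof -
  have e: "of_real v = p * cnj q + cnj p * q"
    "of_real v' = cnj \<omega> * (p * cnj q) + \<omega> * (cnj p * q)"
    "of_real v'' = \<omega> * (p * cnj q) + cnj \<omega> * (cnj p * q)"
    unfolding v_def v'_def v''_def of_real_2_Re using omega_sq
    by (simp_all add: omega_mult_cnj omega_rotate algebra_simps)
  have "complex_of_real (v' + v'') = of_real (- v)"
    unfolding of_real_add of_real_minus e using omega_add_cnj by algebra
  then show "v' + v'' = - v"
    by (simp only: of_real_eq_iff)
  have N: "complex_of_real ((cmod z)\<^sup>2) = z * cnj z" for z
    by (simp add: complex_norm_square del: of_real_power)
  have "complex_of_real (v' * v'') = of_real (v\<^sup>2 - 3 * (cmod p)\<^sup>2 * (cmod q)\<^sup>2)"
    unfolding of_real_mult of_real_diff N of_real_numeral of_real_power [of v] e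
    using omega_mult_cnj omega_add_cnj omega_sq by algebra
  then show "v' * v'' = v\<^sup>2 - 3 * (cmod p)\<^sup>2 * (cmod q)\<^sup>2"
    by (simp only: of_real_eq_iff)
qed

text \<open>The weight is \<open>a\<^sup>2 (m + n v)\<close>, and \<open>a\<^sup>2\<close> is itself linear in \<open>v\<close>.\<close>

lemma quadratic_center_linear:
  assumes "linear_center \<psi> m n"
  shows "quadratic_center \<psi> (\<lambda>N M. 3 * (N + M) * m N M) (\<lambda>N M. 3 * ((N + M) * n - m N M)) (- 3 * n)"
proof -
  have hom: "m (s * N) (s * M) = s * m N M" if "0 < s" for s N M
    using assms that by (simp add: linear_center_def)
  have "opp_side p q * \<psi> (opp_side p q) (opp_side (\<omega> * p) (cnj \<omega> * q))
        (opp_side (cnj \<omega> * p) (\<omega> * q))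
      = 3 * ((cmod p)\<^sup>2 + (cmod q)\<^sup>2) * m ((cmod p)\<^sup>2) ((cmod q)\<^sup>2)
        + 3 * (((cmod p)\<^sup>2 + (cmod q)\<^sup>2) * n - m ((cmod p)\<^sup>2) ((cmod q)\<^sup>2)) * (2 * Re (p * cnj q))
        + - 3 * n * (2 * Re (p * cnj q))\<^sup>2" (is "?a * _ = ?r") for p q
  proof -
    have "?a * \<psi> ?a (opp_side (\<omega> * p) (cnj \<omega> * q)) (opp_side (cnj \<omega> * p) (\<omega> * q))
        = ?a\<^sup>2 * (m ((cmod p)\<^sup>2) ((cmod q)\<^sup>2) + n * (2 * Re (p * cnj q)))"
      using assms unfolding linear_center_def Let_def by (simp add: power2_eq_square mult.assoc)
    then show ?thesis
      unfolding opp_side_sq by algebra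
  qed
  then show ?thesis
    unfolding quadratic_center_def Let_def
    by (intro conjI exI [of _ "\<lambda>_ _ _. 1"])
      (simp_all add: hom power2_eq_square algebra_simps)
qed

text \<open>The weight is \<open>a b c (m + n v') (m + n v'')\<close> with the values \<open>v'\<close>, \<open>v''\<close> at the other two
  vertices, which \<open>rotated_Re\<close> turns into a quadratic polynomial in \<open>v\<close>.\<close>

lemma quadratic_center_recip:
  assumes "linear_center \<psi> m n"
  shows "quadratic_center (recip \<psi>) (\<lambda>N M. (m N M)\<^sup>2 - 3 * n\<^sup>2 * N * M) (\<lambda>N M. - m N M * n) (n\<^sup>2)"
proof -
  have hom: "m (s * N) (s * M) = s * m N M" if "0 < s" for s N M
    using assms that by (simp add: linear_center_def)
  have \<psi>: "\<psi> (opp_side p q) (opp_side (\<omega> * p) (cnj \<omega> * q)) (opp_side (cnj \<omega> * p) (\<omega> * q))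
      = opp_side p q * (m ((cmod p)\<^sup>2) ((cmod q)\<^sup>2) + n * (2 * Re (p * cnj q)))" for p q
    using assms unfolding linear_center_def Let_def by blast
  have "a * recip \<psi> a b c = a * b * c * (((m N M)\<^sup>2 - 3 * n\<^sup>2 * N * M) + - m N M * n * v + n\<^sup>2 * v\<^sup>2)"
    if "a = opp_side p q" "b = opp_side (\<omega> * p) (cnj \<omega> * q)" "c = opp_side (cnj \<omega> * p) (\<omega> * q)"
      and "N = (cmod p)\<^sup>2" "M = (cmod q)\<^sup>2" "v = 2 * Re (p * cnj q)" for a b c N M v p q
  proof -
    define v' v'' where "v' = 2 * Re (\<omega> * p * cnj (cnj \<omega> * q))"
      and "v'' = 2 * Re (cnj \<omega> * p * cnj (\<omega> * q))"
    have "\<psi> b c a = b * (m N M + n * v')"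
      using \<psi> [of "\<omega> * p" "cnj \<omega> * q"]
        by (simp only: that v'_def omega_rotate norm_mult complex_mod_cnj norm_omega mult_1)
    moreover have "\<psi> c a b = c * (m N M + n * v'')"
      using \<psi> [of "cnj \<omega> * p" "\<omega> * q"]
        by (simp only: that v''_def omega_rotate norm_mult complex_mod_cnj norm_omega mult_1)
    moreover have "v' + v'' = - v" "v' * v'' = v\<^sup>2 - 3 * N * M"
      using rotated_Re [of p q] by (simp_all only: that v'_def v''_def)
    ultimately show ?thesis
      unfolding recip_def by algebra
  qed
  then show ?thesis
    unfolding quadratic_center_def Let_def
    by (intro conjI exI [of _ "\<lambda>a b c. a * b * c"])
      (simp_all add: hom power2_eq_square algebra_simps)
qed

text \<open>In Heron's formula, written in the squared sides, the dependence on \<open>v\<close> cancels and a perfect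
  square remains; this is why the area is a function of \<open>N\<close> and \<open>M\<close>.\<close>

lemma sides_sq:
  assumes "a = opp_side p q" "b = opp_side (\<omega> * p) (cnj \<omega> * q)" "c = opp_side (cnj \<omega> * p) (\<omega> * q)"
    and "N = (cmod p)\<^sup>2" "M = (cmod q)\<^sup>2" "v = 2 * Re (p * cnj q)"
  shows "- a\<^sup>2 + b\<^sup>2 + c\<^sup>2 = 3 * (N + M + 2 * v)"
    and "a\<^sup>2 + b\<^sup>2 + c\<^sup>2 = 9 * (N + M)"
    and "area_sides a b c = 3 * sqrt 3 / 4 * \<bar>N - M\<bar>"
proof -
  define v' v'' where "v' = 2 * Re (\<omega> * p * cnj (cnj \<omega> * q))"
    and "v'' = 2 * Re (cnj \<omega> * p * cnj (\<omega> * q))"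
  have v: "v' + v'' = - v" "v' * v'' = v\<^sup>2 - 3 * N * M"
    using rotated_Re [of p q] by (simp_all only: assms v'_def v''_def)
  have sq: "a\<^sup>2 = 3 * (N + M - v)" "b\<^sup>2 = 3 * (N + M - v')" "c\<^sup>2 = 3 * (N + M - v'')"
    by (simp_all only: assms v'_def v''_def opp_side_sq norm_mult complex_mod_cnj norm_omega mult_1)
  show "- a\<^sup>2 + b\<^sup>2 + c\<^sup>2 = 3 * (N + M + 2 * v)" "a\<^sup>2 + b\<^sup>2 + c\<^sup>2 = 9 * (N + M)"
    using v(1) by (simp_all add: sq)
  let ?s = "(a + b + c) / 2"
  have "16 * (?s * (?s - a) * (?s - b) * (?s - c)) = (a\<^sup>2 + b\<^sup>2 + c\<^sup>2)\<^sup>2 - 2 * ((a\<^sup>2)\<^sup>2 + (b\<^sup>2)\<^sup>2 + (c\<^sup>2)\<^sup>2)"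
    by (simp add: field_simps power2_eq_square)
  also have "\<dots> = 27 * (N - M)\<^sup>2"
    unfolding sq using v by algebra
  also have "\<dots> = 16 * (3 * sqrt 3 / 4 * \<bar>N - M\<bar>)\<^sup>2"
    by (simp add: power_mult_distrib power_divide)
  finally have "?s * (?s - a) * (?s - b) * (?s - c) = (3 * sqrt 3 / 4 * \<bar>N - M\<bar>)\<^sup>2"
    by (simp only: mult_cancel_left) simp
  then show "area_sides a b c = 3 * sqrt 3 / 4 * \<bar>N - M\<bar>"
    by (simp add: area_sides_def Let_def)
qed

lemma linear_center_Gamma:
  "linear_center (\<psi>\<^sub>\<Gamma> l0 l1) (\<lambda>N M. 3 * sqrt 3 * (l0 * (N + M) + l1 * \<bar>N - M\<bar>)) (6 * sqrt 3 * l0)"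
proof -
  have "\<bar>s * N - s * M\<bar> = s * \<bar>N - M\<bar>" if "0 < s" for s N M :: real
    using that by (metis abs_mult abs_of_pos right_diff_distrib)
  then show ?thesis
    unfolding linear_center_def Let_def \<psi>\<^sub>\<Gamma>_def sides_sq [OF refl refl refl refl refl refl]
    by (simp add: algebra_simps)
qed

lemma linear_center_Xi:
  "linear_center (\<psi>\<^sub>\<Xi> l0 l1) (\<lambda>N M. (9 * l1 - 3 * l0) * (N + M)) (- 6 * l0)"
  unfolding linear_center_def Let_def \<psi>\<^sub>\<Xi>_def sides_sq [OF refl refl refl refl refl refl]
  by (simp add: algebra_simps)

lemma ex_quadratic_center_Omega:
  assumes "\<psi> \<in> Omega"
  shows "\<exists>k\<^sub>0 k\<^sub>1 k\<^sub>2. quadratic_center \<psi> k\<^sub>0 k\<^sub>1 k\<^sub>2"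
proof -
  obtain \<phi> m n where "linear_center \<phi> m n" "\<psi> = \<phi> \<or> \<psi> = recip \<phi>"
    using assms linear_center_Gamma linear_center_Xi
    unfolding Omega_def Gamma_set_def Xi_set_def by blast
  then show ?thesis
    using quadratic_center_linear quadratic_center_recip by blast
qed

text \<open>For \<open>\<psi>\<^sub>\<Gamma>\<close> with \<open>\<lambda>\<^sub>0 = l = \<plusminus>1\<close> and \<open>\<lambda>\<^sub>1 = 1\<close>, the difference \<open>n N - m\<close> is a multiple of
  \<open>l (N - M) - |N - M|\<close>, and \<open>n M - m\<close> one of \<open>- l (N - M) - |N - M|\<close>; one of the two is zero. Which
  one depends on the orientation of the triangle. Each of the two components of the displacement,
  for the function and for its reciprocal, contains one of these factors.\<close>

lemma ex_quadratic_center_Omega_inv: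
  assumes "\<psi> \<in> Omega_inv"
  shows "\<exists>k\<^sub>0 k\<^sub>1 k\<^sub>2. quadratic_center \<psi> k\<^sub>0 k\<^sub>1 k\<^sub>2 \<and>
    (\<forall>N M. k\<^sub>1 N M + k\<^sub>2 * M = 0 \<or> k\<^sub>1 N M + k\<^sub>2 * N = 0)"
proof -
  obtain l where l: "l = 1 \<or> l = -1" and \<psi>: "\<psi> = \<psi>\<^sub>\<Gamma> l 1 \<or> \<psi> = recip (\<psi>\<^sub>\<Gamma> l 1)"
    using assms unfolding Omega_inv_def by blast
  define m where "m = (\<lambda>N M. 3 * sqrt 3 * (l * (N + M) + \<bar>N - M\<bar>))"
  define n where "n = 6 * sqrt 3 * l"
  have lin: "linear_center (\<psi>\<^sub>\<Gamma> l 1) m n"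
    using linear_center_Gamma [of l 1] by (simp add: m_def n_def)
  have zero: "n * N = m N M \<or> n * M = m N M" for N M
    using l by (auto simp: m_def n_def abs_if algebra_simps)
  show ?thesis
    using \<psi>
  proof
    assume "\<psi> = \<psi>\<^sub>\<Gamma> l 1"
    moreover have "3 * ((N + M) * n - m N M) + - 3 * n * M = 0 \<or>
        3 * ((N + M) * n - m N M) + - 3 * n * N = 0" for N M
      using zero [of N M] by (auto simp: algebra_simps)
    ultimately show ?thesis
      using quadratic_center_linear [OF lin] by blast
  next
    assume "\<psi> = recip (\<psi>\<^sub>\<Gamma> l 1)"
    moreover have "- m N M * n + n\<^sup>2 * M = 0 \<or> - m N M * n + n\<^sup>2 * N = 0" for N M
      using zero [of N M] by (auto simp: power2_eq_square)
    ultimately show ?thesis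
      using quadratic_center_recip [OF lin] by blast
  qed
qed

section \<open>The curve of a triangle center\<close>

text \<open>The cube in \<open>c\<^sup>3\<close> restores the full angle \<open>\<theta>\<close>. Its modulus \<open>|r|\<^sup>3\<close> is reduced to \<open>|r|\<close> by the
  real coefficients, which are homogeneous of degree \<open>-1\<close> in \<open>(N, M)\<close>, that is \<open>-2\<close> in \<open>r\<close>.\<close>

lemma displacement_family:
  fixes r \<theta> :: real
  defines "c \<equiv> of_real r * cis ((pi - \<theta>) / 3)"
  assumes "quadratic_center \<psi> k\<^sub>0 k\<^sub>1 k\<^sub>2" and "r \<noteq> 0"
    and xy: "displacement k\<^sub>0 k\<^sub>1 k\<^sub>2 p q = (x, y)"
  shows "displacement k\<^sub>0 k\<^sub>1 k\<^sub>2 (c * p) (cnj c * q)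
    = (- (of_real r * cis (- \<theta>)) * x, - (of_real r * cis \<theta>) * y)"
proof -
  define N M where NM: "N = (cmod p)\<^sup>2" "M = (cmod q)\<^sup>2"
  have r2: "0 < r\<^sup>2"
    using assms by simp
  have hom: "k\<^sub>0 (r\<^sup>2 * N) (r\<^sup>2 * M) = (r\<^sup>2)\<^sup>2 * k\<^sub>0 N M" "k\<^sub>1 (r\<^sup>2 * N) (r\<^sup>2 * M) = r\<^sup>2 * k\<^sub>1 N M"
    using assms(2) r2 unfolding quadratic_center_def by blast+
  have norms: "(cmod (c * p))\<^sup>2 = r\<^sup>2 * N" "(cmod (cnj c * q))\<^sup>2 = r\<^sup>2 * M"
    by (simp_all add: c_def norm_mult power_mult_distrib NM)
  have "cis ((pi - \<theta>) / 3) ^ 3 = cis (pi - \<theta>)"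
    by (subst Complex.DeMoivre) (simp add: diff_divide_distrib)
  also have "\<dots> = - cis (- \<theta>)"
    by (simp add: complex_eq_iff)
  finally have c3: "c ^ 3 = - of_real (r ^ 3) * cis (- \<theta>)"
    by (simp add: c_def power_mult_distrib)
  have modes: "(c * p)\<^sup>2 * cnj (cnj c * q) = - of_real (r ^ 3) * cis (- \<theta>) * (p\<^sup>2 * cnj q)"
    "cnj (c * p) * (cnj c * q)\<^sup>2 = - of_real (r ^ 3) * cis \<theta> * (cnj p * q\<^sup>2)"
  proof -
    have "(c * p)\<^sup>2 * cnj (cnj c * q) = c ^ 3 * (p\<^sup>2 * cnj q)"
      by (simp add: power2_eq_square power3_eq_cube)
    then show "(c * p)\<^sup>2 * cnj (cnj c * q) = - of_real (r ^ 3) * cis (- \<theta>) * (p\<^sup>2 * cnj q)"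
      by (simp only: c3)
    have "cnj (c * p) * (cnj c * q)\<^sup>2 = cnj (c ^ 3) * (cnj p * q\<^sup>2)"
      by (simp add: power2_eq_square power3_eq_cube)
    then show "cnj (c * p) * (cnj c * q)\<^sup>2 = - of_real (r ^ 3) * cis \<theta> * (cnj p * q\<^sup>2)"
      by (simp add: c3 cis_cnj)
  qed
  define D where "D = k\<^sub>0 N M + 2 * k\<^sub>2 * N * M"
  have D: "(r\<^sup>2)\<^sup>2 * k\<^sub>0 N M + 2 * k\<^sub>2 * (r\<^sup>2 * N) * (r\<^sup>2 * M) = (r\<^sup>2)\<^sup>2 * D"
    by (simp add: D_def power2_eq_square algebra_simps)
  have coeff: "of_real ((r\<^sup>2 * k\<^sub>1 N M + k\<^sub>2 * (r\<^sup>2 * K)) / ((r\<^sup>2)\<^sup>2 * D)) * (- of_real (r ^ 3) * e * z)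
      = - (of_real r * e) * (of_real ((k\<^sub>1 N M + k\<^sub>2 * K) / D) * z)"
    for K :: real and e z :: complex
  proof -
    have "(r\<^sup>2 * k\<^sub>1 N M + k\<^sub>2 * (r\<^sup>2 * K)) / ((r\<^sup>2)\<^sup>2 * D) * r ^ 3 = r * ((k\<^sub>1 N M + k\<^sub>2 * K) / D)"
      using assms(3)
      by (cases "D = 0") (simp_all add: field_simps power2_eq_square power3_eq_cube)
    from arg_cong [OF this, of complex_of_real] show ?thesis
      by (simp only: of_real_mult) algebra
  qed
  show ?thesis
    using xy unfolding displacement_def Let_def norms hom modes D NM [symmetric] D_def [symmetric] coeff
    by blast
qed

lemma center_scaled_family_triangle:
  assumes "quadratic_center \<psi> k\<^sub>0 k\<^sub>1 k\<^sub>2" and pq: "cmod p \<noteq> cmod q" and r: "r t \<noteq> 0"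
    and xy: "displacement k\<^sub>0 k\<^sub>1 k\<^sub>2 p q = (x, y)"
    and def: "center_defined (scaled \<psi> \<sigma>)
      (family_triangle (target_family r \<theta>) (modal_triangle g p q) t)"
  shows "center (scaled \<psi> \<sigma>) (family_triangle (target_family r \<theta>) (modal_triangle g p q) t)
    = real_affine g (of_real (\<sigma> - 1) * y) (of_real (\<sigma> - 1) * x) (target_curve r \<theta> t)"
proof -
  define c where "c = of_real (r t) * cis ((pi - \<theta> t) / 3)"
  have fam: "family_triangle (target_family r \<theta>) (modal_triangle g p q) t
      = modal_triangle g (c * p) (cnj c * q)"
    unfolding c_def by (rule family_triangle_modal_triangle)
  obtain A B C where T: "modal_triangle g (c * p) (cnj c * q) = (A, B, C)"
    by (metis prod_cases3)
  have "cmod (c * p) \<noteq> cmod (cnj c * q)"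
    using pq r by (simp add: norm_mult c_def)
  then have ne: "d * (c * p) \<noteq> e * (cnj c * q)" if "cmod d = 1" "cmod e = 1" for d e
    using that by (metis mult_1 norm_mult)
  have "A \<noteq> B" "B \<noteq> C" "C \<noteq> A"
    using sides_modal_triangle [OF T] ne [of 1 1] ne [of \<omega> "cnj \<omega>"] ne [of "cnj \<omega>" \<omega>]
    by (auto simp: opp_side_def)
  note sc = center_scaled [OF def [unfolded fam T] this]
  have "A + B + C = pt (of_real 3 * g)"
  proof -
    have "A + B + C = pt (3 * g + (1 + \<omega> + cnj \<omega>) * (c * p) + (1 + \<omega> + cnj \<omega>) * (cnj c * q))"
      using T by (auto simp: modal_triangle_def pt_add [symmetric] algebra_simps)
    then show ?thesis
      by (simp add: omega_add_cnj)
  qed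
  then have g: "(1 / 3) *\<^sub>R (A + B + C) = pt g"
    by (simp only: pt_scaleR) simp
  have "center \<psi> (A, B, C)
      = pt (g + - (of_real (r t) * cis (- \<theta> t)) * x + - (of_real (r t) * cis (\<theta> t)) * y)"
    unfolding T [symmetric] using sc(1) [folded T] displacement_family [OF assms(1) r xy]
    by (intro center_quadratic_center [OF assms(1)]) (auto simp: c_def)
  then show ?thesis
    unfolding fam T sc(2) g
    by (simp add: real_affine_def target_curve_eq_pt cis_cnj pt_scaleR [symmetric] pt_add [symmetric]
        algebra_simps)
qed

text \<open>The affine map is built from the displacement of \<open>\<Delta>\<close> itself, so it does not depend on the target
  curve. If the denominator of the displacement is 0, then the center of every family triangle is
  undefined and any map would do.\<close>

lemma scaled_center_curve:
  assumes "quadratic_center \<psi> k\<^sub>0 k\<^sub>1 k\<^sub>2" and "\<Delta> \<in> triangles"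
  shows "\<exists>F. affine_transformation F \<and>
    ((\<forall>N M. k\<^sub>1 N M + k\<^sub>2 * M = 0 \<or> k\<^sub>1 N M + k\<^sub>2 * N = 0) \<longrightarrow> unsheared F) \<and>
    (\<forall>r \<theta> t. r t \<noteq> 0 \<longrightarrow>
      center_defined (scaled \<psi> \<sigma>) (family_triangle (target_family r \<theta>) \<Delta> t) \<longrightarrow>
      center (scaled \<psi> \<sigma>) (family_triangle (target_family r \<theta>) \<Delta> t) = F (target_curve r \<theta> t))"
proof -
  obtain g p q where \<Delta>: "\<Delta> = modal_triangle g p q"
    using ex_modal_triangle by blast
  have pq: "cmod p \<noteq> cmod q"
    using assms(2) nondegenerate_modes by (simp add: \<Delta>)
  obtain x y where xy: "displacement k\<^sub>0 k\<^sub>1 k\<^sub>2 p q = (x, y)"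
    by fastforce
  let ?F = "real_affine g (of_real (\<sigma> - 1) * y) (of_real (\<sigma> - 1) * x)"
  have "unsheared ?F" if "\<forall>N M. k\<^sub>1 N M + k\<^sub>2 * M = 0 \<or> k\<^sub>1 N M + k\<^sub>2 * N = 0"
  proof (rule unsheared_real_affine)
    have "x = 0 \<or> y = 0"
      using that [rule_format, of "(cmod p)\<^sup>2" "(cmod q)\<^sup>2"] xy
      by (auto simp: displacement_def Let_def simp del: of_real_add)
    then show "of_real (\<sigma> - 1) * y = 0 \<or> of_real (\<sigma> - 1) * x = 0"
      by auto
  qed
  then show ?thesis
    using affine_transformation_real_affine center_scaled_family_triangle [OF assms(1) pq _ xy]
    unfolding \<Delta> by blast
qed

theorem theorem2:
  fixes \<psi> :: center_fun and \<Delta> :: triangle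
  assumes "\<psi> \<in> scaled_family Omega"
    and "\<Delta> \<in> triangles"
    and "\<not> equilateral \<Delta>"
  shows "\<exists>F. affine_transformation F \<and>
           (\<psi> \<in> scaled_family Omega_inv \<longrightarrow> unsheared F) \<and>
           (\<forall>r \<theta>. (\<forall>t\<in>param_interval. r t \<noteq> 0) \<longrightarrow>
             (\<forall>t\<in>param_interval. center_defined \<psi> (family_triangle (target_family r \<theta>) \<Delta> t) \<longrightarrow>
               center \<psi> (family_triangle (target_family r \<theta>) \<Delta> t) = F (target_curve r \<theta> t)))"
proof -
  \<comment> \<open>A function may be a member of the scaled family in several ways; if one of them is through
    \<open>Omega_inv\<close>, that one has to be chosen.\<close>
  have "\<exists>\<phi> \<sigma> k\<^sub>0 k\<^sub>1 k\<^sub>2. \<psi> = scaled \<phi> \<sigma> \<and> quadratic_center \<phi> k\<^sub>0 k\<^sub>1 k\<^sub>2 \<and>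
    (\<psi> \<in> scaled_family Omega_inv \<longrightarrow> (\<forall>N M. k\<^sub>1 N M + k\<^sub>2 * M = 0 \<or> k\<^sub>1 N M + k\<^sub>2 * N = 0))"
  proof (cases "\<psi> \<in> scaled_family Omega_inv")
    case True
    then obtain \<phi> \<sigma> where "\<psi> = scaled \<phi> \<sigma>" "\<phi> \<in> Omega_inv"
      by (auto simp: scaled_family_def)
    then show ?thesis
      using ex_quadratic_center_Omega_inv by blast
  next
    case False
    then show ?thesis
      using assms(1) ex_quadratic_center_Omega by (fastforce simp: scaled_family_def)
  qed
  then obtain \<phi> \<sigma> k\<^sub>0 k\<^sub>1 k\<^sub>2 where \<psi>: "\<psi> = scaled \<phi> \<sigma>" and quad: "quadratic_center \<phi> k\<^sub>0 k\<^sub>1 k\<^sub>2"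
    and inv: "\<psi> \<in> scaled_family Omega_inv \<longrightarrow>
      (\<forall>N M. k\<^sub>1 N M + k\<^sub>2 * M = 0 \<or> k\<^sub>1 N M + k\<^sub>2 * N = 0)"
    by blast
  show ?thesis
    using scaled_center_curve [OF quad assms(2), of \<sigma>] inv unfolding \<psi> by blast
qed

end
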